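(* Let $\bar\lambda=\langle\lambda_i: i<\kappa\rangle$ be a sequence of infinite regular cardinals, $I^*$ an ideal on $\kappa$ and $\theta$ a cardinal such that at least one of the following holds: ($\alpha$) $\min_{i<\kappa}\lambda_i>\theta\ge \mathrm{wsat}(I^* )$; or ($\beta$) $\liminf_{I^*}(\bar\lambda)\ge\theta\ge\mathrm{wsat}(I^* )$ and $(\prod\bar\lambda,\le_{I^*})$ is $\theta^+$-directed. Let $\sigma$ be a cardinal; for $j<\sigma$ let $D_j$ be a filter on $\kappa$ extending $\{\kappa\setminus A: A\in I^*\}$; let $E$ be a filter on $\sigma$ and let $D^*=\{B\subseteq\kappa:\{j<\sigma: B\in D_j\}\in E\}$ (a filter on $\kappa$). Assume that $\mu_j=\mathrm{tcf}(\prod\bar\lambda,<_{D_j})$ is well defined for every $j<\sigma$ and that $\mu_j>\sigma+\theta$ for every $j<\sigma$. Put $$\lambda=\mathrm{tcf}\big(\prod\bar\lambda,<_{D^*}\big),\qquad \mu=\mathrm{tcf}\big(\prod_{j<\sigma}\mu_j,<_E\big).$$ Then $\lambda=\mu$; in particular, if one of them is well defined then so is the other.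
   Context: $\kappa$ is an infinite cardinal; $I^*$ is a proper ideal on $\kappa$; $\prod\bar\lambda=\prod_{i<\kappa}\lambda_i$. For an ideal $J$, $f\le_J g$ means $\{i:\neg f(i)\le g(i)\}\in J$, similarly $<_J$; for a filter $D$, $<_D,\le_D$ refer to the dual ideal. Filters are proper. $I^+=\mathcal P(\kappa)\setminus I$. A (quasi-)partial order $P$ is $\lambda$-directed if every $A\subseteq P$ with $|A|<\lambda$ has an upper bound in $P$. $P$ has true cofinality $\lambda$ if there is a strictly increasing sequence $\langle p_\alpha:\alpha<\lambda\rangle$ in $P$ such that every $q\in P$ satisfies $q\le p_\alpha$ for some $\alpha$; $\mathrm{tcf}(P)$ is the least such $\lambda$ (well defined iff such a sequence exists). $\liminf_{I}(\bar\lambda)=\min\{\mu:\{i<\kappa:\lambda_i\le\mu\}\in I^+\}$. $\mathrm{wsat}(I)$ is the least cardinal $\theta$ such that $\kappa$ cannot be partitioned into $\theta$ pairwise disjoint sets each in $I^+$. *)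

theory Defs
  imports Main "HOL-Library.FuncSet" "HOL-Library.Disjoint_Sets"
begin

unbundle cardinal_syntax

text \<open>
  Cardinals are the cardinal orders of the HOL library: relations \<open>r\<close> with \<open>Card_order r\<close>,
  compared by \<open><o\<close>, \<open>\<le>o\<close>, \<open>=o\<close> also across different carrier types.  The ordinals below the
  cardinal \<open>r\<close> are the elements of \<open>Field r\<close>, ordered by \<open>r\<close>.
\<close>

text \<open>
  The least cardinal with property \<open>P\<close>, unique up to \<open>=o\<close>.  Minimality is over cardinal orders
  on the type \<open>'a\<close>; if \<open>P\<close> respects \<open>=o\<close>, this loses nothing, because every cardinal \<open>s <o r\<close>,
  of whatever type, has a copy on a subset of \<open>Field r\<close>.
\<close>
definition is_least_card :: "('a rel \<Rightarrow> bool) \<Rightarrow> 'a rel \<Rightarrow> bool" where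
  "is_least_card P r \<longleftrightarrow>
     Card_order r \<and> P r \<and> (\<forall>s :: 'a rel. Card_order s \<and> P s \<longrightarrow> r \<le>o s)"

definition least_card :: "('a rel \<Rightarrow> bool) \<Rightarrow> 'a rel" where
  "least_card P = (SOME r. is_least_card P r)"

lemma is_least_card_least_card:
  assumes "Card_order r" "P r"
  shows "is_least_card P (least_card P)"
proof -
  have "\<exists>r \<in> {r. Card_order r \<and> P r}. \<forall>r' \<in> {r. Card_order r \<and> P r}. r \<le>o r'"
    by (rule exists_minim_Card_order) (use assms in auto)
  then have "\<exists>r. is_least_card P r"
    unfolding is_least_card_def by auto
  then show ?thesis
    unfolding least_card_def by (rule someI_ex)
qed

definition directed_card :: "'t rel \<Rightarrow> 'p set \<Rightarrow> ('p \<Rightarrow> 'p \<Rightarrow> bool) \<Rightarrow> bool" where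
  "directed_card r P le \<longleftrightarrow>
     (\<forall>A \<subseteq> P. |A| <o r \<longrightarrow> (\<exists>u \<in> P. \<forall>a \<in> A. le a u))"

definition true_cofinality ::
  "'p set \<Rightarrow> ('p \<Rightarrow> 'p \<Rightarrow> bool) \<Rightarrow> ('p \<Rightarrow> 'p \<Rightarrow> bool) \<Rightarrow> 'c rel \<Rightarrow> bool" where
  "true_cofinality P le lt r \<longleftrightarrow>
     (\<exists>p. (\<forall>\<alpha> \<in> Field r. p \<alpha> \<in> P) \<and>
          (\<forall>\<alpha> \<beta>. (\<alpha>, \<beta>) \<in> r \<and> \<alpha> \<noteq> \<beta> \<longrightarrow> lt (p \<alpha>) (p \<beta>)) \<and>
          (\<forall>q \<in> P. \<exists>\<alpha> \<in> Field r. le q (p \<alpha>)))"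

text \<open>
  The cardinal orders on the element type \<open>'p\<close> suffice: if \<open>lt\<close> is irreflexive, a strictly
  increasing sequence in \<open>P\<close> is injective, so its length has a copy on a subset of \<open>P\<close>.
\<close>
definition has_tcf :: "'p set \<Rightarrow> ('p \<Rightarrow> 'p \<Rightarrow> bool) \<Rightarrow> ('p \<Rightarrow> 'p \<Rightarrow> bool) \<Rightarrow> bool" where
  "has_tcf P le lt \<longleftrightarrow> (\<exists>r :: 'p rel. Card_order r \<and> true_cofinality P le lt r)"

definition tcf :: "'p set \<Rightarrow> ('p \<Rightarrow> 'p \<Rightarrow> bool) \<Rightarrow> ('p \<Rightarrow> 'p \<Rightarrow> bool) \<Rightarrow> 'p rel" where
  "tcf P le lt = least_card (true_cofinality P le lt)"

definition proper_ideal :: "'k set set \<Rightarrow> bool" where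
  "proper_ideal I \<longleftrightarrow>
     {} \<in> I \<and> (\<forall>A \<in> I. \<forall>B. B \<subseteq> A \<longrightarrow> B \<in> I) \<and> (\<forall>A \<in> I. \<forall>B \<in> I. A \<union> B \<in> I) \<and> UNIV \<notin> I"

definition dual_ideal :: "'k filter \<Rightarrow> 'k set set" where
  "dual_ideal D = {A. \<forall>\<^sub>F i in D. i \<notin> A}"

definition card_prod :: "('k \<Rightarrow> 'a rel) \<Rightarrow> ('k \<Rightarrow> 'a) set" where
  "card_prod lam = (\<Pi> i \<in> UNIV. Field (lam i))"

definition le_mod :: "'k set set \<Rightarrow> ('k \<Rightarrow> 'a rel) \<Rightarrow> ('k \<Rightarrow> 'a) \<Rightarrow> ('k \<Rightarrow> 'a) \<Rightarrow> bool" where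
  "le_mod J lam f g \<longleftrightarrow> {i. \<not> (f i, g i) \<in> lam i} \<in> J"

definition less_mod :: "'k set set \<Rightarrow> ('k \<Rightarrow> 'a rel) \<Rightarrow> ('k \<Rightarrow> 'a) \<Rightarrow> ('k \<Rightarrow> 'a) \<Rightarrow> bool" where
  "less_mod J lam f g \<longleftrightarrow> {i. \<not> ((f i, g i) \<in> lam i \<and> f i \<noteq> g i)} \<in> J"

definition has_prod_tcf :: "('k \<Rightarrow> 'a rel) \<Rightarrow> 'k filter \<Rightarrow> bool" where
  "has_prod_tcf lam D \<longleftrightarrow>
     has_tcf (card_prod lam) (le_mod (dual_ideal D) lam) (less_mod (dual_ideal D) lam)"

definition prod_tcf :: "('k \<Rightarrow> 'a rel) \<Rightarrow> 'k filter \<Rightarrow> ('k \<Rightarrow> 'a) rel" where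
  "prod_tcf lam D =
     tcf (card_prod lam) (le_mod (dual_ideal D) lam) (less_mod (dual_ideal D) lam)"

text \<open>
  The minimum exists among cardinal orders on \<open>'a\<close>, since every \<open>lam i\<close> is at most the
  cardinality of \<open>'a\<close>.
\<close>
definition liminf_mod :: "'k set set \<Rightarrow> ('k \<Rightarrow> 'a rel) \<Rightarrow> 'a rel" where
  "liminf_mod I lam = least_card (\<lambda>m. {i. lam i \<le>o m} \<notin> I)"

text \<open>
  Only nonzero cardinals \<open>r\<close> are considered: a nonempty set has no partition into \<open>0\<close> parts, so
  allowing \<open>0\<close> would make the least such cardinal \<open>0\<close> for every ideal.  The minimum exists among
  cardinal orders on \<open>'k set\<close>, since the successor of the cardinality of \<open>'k\<close> qualifies.
\<close>
definition wsat :: "'k set set \<Rightarrow> 'k set rel" where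
  "wsat I = least_card (\<lambda>r. Field r \<noteq> {} \<and>
     \<not> (\<exists>\<A>. partition_on UNIV \<A> \<and> (\<forall>A \<in> \<A>. A \<notin> I) \<and> |\<A>| =o r))"

lemma is_least_card_liminf_mod:
  fixes lam :: "'k \<Rightarrow> 'a rel"
  assumes "proper_ideal I" "\<And>i. Card_order (lam i)"
  shows "is_least_card (\<lambda>m. {i. lam i \<le>o m} \<notin> I) (liminf_mod I lam)"
  unfolding liminf_mod_def
proof (rule is_least_card_least_card)
  show "Card_order |UNIV :: 'a set|" by (rule card_of_Card_order)
  have "lam i \<le>o |UNIV :: 'a set|" for i
    using assms(2) by (meson card_of_Field_ordIso card_of_mono1 ordIso_ordLeq_trans ordIso_symmetric
        subset_UNIV)
  then show "{i. lam i \<le>o |UNIV :: 'a set|} \<notin> I"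
    using assms(1) by (simp add: proper_ideal_def)
qed

lemma is_least_card_wsat:
  fixes I :: "'k set set"
  shows "is_least_card (\<lambda>r. Field r \<noteq> {} \<and>
     \<not> (\<exists>\<A>. partition_on UNIV \<A> \<and> (\<forall>A \<in> \<A>. A \<notin> I) \<and> |\<A>| =o r)) (wsat I)"
  unfolding wsat_def
proof (rule is_least_card_least_card)
  let ?r = "cardSuc |UNIV :: 'k set|"
  show card: "Card_order ?r" by (rule cardSuc_Card_order[OF card_of_Card_order])
  have less: "|UNIV :: 'k set| <o ?r" by (rule cardSuc_greater[OF card_of_Card_order])
  have "\<not> |\<A>| =o ?r" if part: "partition_on UNIV \<A>" for \<A> :: "'k set set"
  proof
    assume "|\<A>| =o ?r"
    have "inj_on (\<lambda>A. SOME x. x \<in> A) \<A>"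
    proof (rule inj_onI)
      fix A B assume AB: "A \<in> \<A>" "B \<in> \<A>" "(SOME x. x \<in> A) = (SOME x. x \<in> B)"
      have "A \<noteq> {}" "B \<noteq> {}" using part AB by (auto simp: partition_on_def)
      then have "(SOME x. x \<in> A) \<in> A" "(SOME x. x \<in> B) \<in> B" by (simp_all add: some_in_eq)
      then show "A = B" using part AB by (auto simp: partition_on_def disjoint_def)
    qed
    then have "|\<A>| \<le>o |UNIV :: 'k set|"
      using card_of_ordLeq by blast
    then show False
      using \<open>|\<A>| =o ?r\<close> less by (meson not_ordLess_ordIso ordLeq_ordLess_trans)
  qed
  moreover have "Field ?r \<noteq> {}"
  proof
    assume "Field ?r = {}"
    moreover have "|Field ?r| =o ?r" by (rule card_of_Field_ordIso[OF card])
    ultimately have "|UNIV :: 'k set| <o |{} :: 'k set set|"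
      using less by (metis ordIso_symmetric ordLess_ordIso_trans)
    then show False
      by (meson card_of_empty not_ordLess_ordLeq)
  qed
  ultimately show "Field ?r \<noteq> {} \<and>
     \<not> (\<exists>\<A>. partition_on UNIV \<A> \<and> (\<forall>A \<in> \<A>. A \<notin> I) \<and> |\<A>| =o ?r)"
    by blast
qed

definition bind_filter :: "'s filter \<Rightarrow> ('s \<Rightarrow> 'k filter) \<Rightarrow> 'k filter" where
  "bind_filter E D = Abs_filter (\<lambda>P. \<forall>\<^sub>F j in E. \<forall>\<^sub>F i in D j. P i)"

lemma eventually_bind_filter:
  "eventually P (bind_filter E D) \<longleftrightarrow> (\<forall>\<^sub>F j in E. \<forall>\<^sub>F i in D j. P i)"
  unfolding bind_filter_def
proof (rule eventually_Abs_filter, rule is_filter.intro)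
  show "\<forall>\<^sub>F j in E. \<forall>\<^sub>F i in D j. True" by simp
next
  fix P Q
  assume "\<forall>\<^sub>F j in E. \<forall>\<^sub>F i in D j. P i" "\<forall>\<^sub>F j in E. \<forall>\<^sub>F i in D j. Q i"
  then show "\<forall>\<^sub>F j in E. \<forall>\<^sub>F i in D j. P i \<and> Q i"
    by eventually_elim (simp add: eventually_conj)
next
  fix P Q
  assume "\<forall>i. P i \<longrightarrow> Q i" "\<forall>\<^sub>F j in E. \<forall>\<^sub>F i in D j. P i"
  then show "\<forall>\<^sub>F j in E. \<forall>\<^sub>F i in D j. Q i"
    by (auto elim!: eventually_mono)
qed

end

theory Submission
  imports Defs
begin

text \<open>
  True cofinality is reduced to directedness: an unbounded quasi-order has a true cofinality iff
  it is \<open>|S|\<close>-directed for a dominating set \<open>S\<close> of least cardinality, and the true cofinality is then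
  \<open>|S|\<close> (\<open>has_tcf_iff_directed\<close>, \<open>tcf_ordIso\<close>).  Both the least size of a dominating set and
  directedness are carried along Tukey connections, so two quasi-orders connected in both
  directions have the same true cofinality (\<open>Tukey_tcf\<close>).

  Such connections between the product of the \<open>\<lambda>\<^sub>i\<close> modulo \<open>D\<^sup>*\<close> and the product of the \<open>\<mu>\<^sub>j\<close> modulo \<open>E\<close>
  come from scales \<open>p\<^sub>j\<close> of length \<open>\<mu>\<^sub>j\<close> modulo \<open>D\<^sub>j\<close>.  The map \<open>F\<close> sends \<open>f\<close> to a family of indices
  \<open>F f j\<close> with \<open>f \<le> p\<^sub>j (F f j)\<close> modulo \<open>D\<^sub>j\<close>; the map \<open>G\<close> sends \<open>g\<close> to one function that is above
  \<open>p\<^sub>j (g j)\<close> modulo \<open>D\<^sub>j\<close> for all \<open>j\<close> at once.  Because each \<open>p\<^sub>j\<close> is strictly increasing,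
  \<open>G g \<le> f\<close> implies \<open>g \<le> F f\<close> and \<open>F f \<le> g\<close> implies \<open>f \<le> G g\<close>.

  The point is the existence of \<open>G\<close>.  As \<open>\<sigma> < \<mu>\<^sub>j\<close>, the functions \<open>p\<^sub>k (g k)\<close> have a common bound modulo
  each single \<open>D\<^sub>j\<close>, and the lemma \<open>bounded_mod_Sup\<close> turns these bounds into one bound modulo
  all \<open>D\<^sub>j\<close> simultaneously.  It is the argument for the directedness of products modulo the ideals
  \<open>J\<^sub><\<^sub>\<lambda>\<close> of pcf theory: repeated failures to bound an increasing family would produce
  \<open>wsat(I\<^sup>*)\<close> many disjoint sets outside \<open>I\<^sup>*\<close>.
\<close>

section \<open>Recursion along a cardinal\<close>

text \<open>
  The new value depends only on the set \<open>Y\<close> of the earlier values.  The number of predecessors is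
  kept as the bound on \<open>|Y|\<close>, and not merely \<open>r\<close>, because the recursion behind \<open>bounded_mod_Sup\<close>
  neglects the coordinates whose cardinal is at most that number.
\<close>

lemma underS_recursion:
  fixes r :: "'a rel" and P :: "'b set"
  assumes r: "Card_order r"
    and step: "\<And>x Y. x \<in> Field r \<Longrightarrow> Y \<subseteq> P \<Longrightarrow> |Y| \<le>o |underS r x| \<Longrightarrow> \<exists>v \<in> P. Q x Y v"
  shows "\<exists>f. \<forall>x \<in> Field r. f x \<in> P \<and> Q x (f ` underS r x) (f x)"
proof -
  have wf: "wf (r - Id)"
    using r by (simp add: card_order_on_def well_order_on_def)
  have "\<exists>f. \<forall>x. x \<in> Field r \<longrightarrow> f x \<in> P \<and> Q x (f ` underS r x) (f x)"
  proof (rule dependent_wf_choice[OF wf])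
    fix f g :: "'a \<Rightarrow> 'b" and x v
    assume "\<And>z. (z, x) \<in> r - Id \<Longrightarrow> f z = g z"
    then have "f ` underS r x = g ` underS r x"
      by (auto simp: underS_def intro!: image_cong)
    then show "(x \<in> Field r \<longrightarrow> v \<in> P \<and> Q x (f ` underS r x) v) =
               (x \<in> Field r \<longrightarrow> v \<in> P \<and> Q x (g ` underS r x) v)"
      by simp
  next
    fix x f
    assume IH: "\<And>y. (y, x) \<in> r - Id \<Longrightarrow> y \<in> Field r \<longrightarrow> f y \<in> P \<and> Q y (f ` underS r y) (f y)"
    have "f ` underS r x \<subseteq> P"
      using IH by (auto simp: underS_def intro: FieldI1)
    then show "\<exists>v. x \<in> Field r \<longrightarrow> v \<in> P \<and> Q x (f ` underS r x) v"
      using step[of x "f ` underS r x"] card_of_image by blast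
  qed
  then show ?thesis by blast
qed

lemma Card_order_linear:
  assumes "Card_order r" "a \<in> Field r" "b \<in> Field r"
  shows "(a, b) \<in> r \<or> b \<in> underS r a"
proof -
  have "total_on (Field r) r" "refl_on (Field r) r"
    using assms(1) unfolding card_order_on_def well_order_on_def linear_order_on_def
      partial_order_on_def preorder_on_def by blast+
  then have "a \<noteq> b \<Longrightarrow> (a, b) \<in> r \<or> (b, a) \<in> r" "(a, a) \<in> r"
    using assms(2,3) by (auto simp: total_on_def refl_on_def)
  then show ?thesis unfolding underS_def by (cases "a = b") simp_all
qed

lemma Card_order_trans:
  assumes "Card_order r" "(a, b) \<in> r" "(b, c) \<in> r"
  shows "(a, c) \<in> r"
proof -
  have "trans r"
    using assms(1) unfolding card_order_on_def well_order_on_def linear_order_on_def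
      partial_order_on_def preorder_on_def by blast
  then show ?thesis using assms(2,3) by (rule transD)
qed

lemma Card_order_antisym:
  assumes "Card_order r" "(a, b) \<in> r" "(b, a) \<in> r"
  shows "a = b"
proof -
  have "antisym r"
    using assms(1) unfolding card_order_on_def well_order_on_def linear_order_on_def
      partial_order_on_def by blast
  then show ?thesis using assms(2,3) by (rule antisymD)
qed

lemma Card_order_refl:
  assumes "Card_order r" "a \<in> Field r"
  shows "(a, a) \<in> r"
  using Card_order_linear[OF assms assms(2)] by (simp add: underS_def)

lemma directed_cardD:
  "directed_card r P le \<Longrightarrow> A \<subseteq> P \<Longrightarrow> |A| <o r \<Longrightarrow> \<exists>u \<in> P. \<forall>a \<in> A. le a u"
  by (simp add: directed_card_def)

lemma finite_card_of_ordLess: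
  assumes "Card_order r" "infinite (Field r)" "finite A"
  shows "|A| <o r"
  using assms by (auto intro!: finite_ordLess_infinite card_of_Well_order
      simp: Field_card_of card_order_on_well_order_on)

section \<open>True cofinality as directedness\<close>

locale unbounded_quasi_order =
  fixes P :: "'p set" and le lt :: "'p \<Rightarrow> 'p \<Rightarrow> bool"
  assumes nonempty: "P \<noteq> {}"
    and le_refl: "x \<in> P \<Longrightarrow> le x x"
    and le_trans: "le x y \<Longrightarrow> le y z \<Longrightarrow> le x z"
    and lt_le: "lt x y \<Longrightarrow> le x y"
    and lt_not_le: "lt x y \<Longrightarrow> \<not> le y x"
    and le_lt_trans: "le x y \<Longrightarrow> lt y z \<Longrightarrow> lt x z"
    and unbounded: "x \<in> P \<Longrightarrow> \<exists>y \<in> P. lt x y"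

definition dominating :: "'p set \<Rightarrow> ('p \<Rightarrow> 'p \<Rightarrow> bool) \<Rightarrow> 'p set \<Rightarrow> bool" where
  "dominating P le S \<longleftrightarrow> S \<subseteq> P \<and> (\<forall>q \<in> P. \<exists>s \<in> S. le q s)"

definition least_dominating :: "'p set \<Rightarrow> ('p \<Rightarrow> 'p \<Rightarrow> bool) \<Rightarrow> 'p set \<Rightarrow> bool" where
  "least_dominating P le S \<longleftrightarrow> dominating P le S \<and> (\<forall>T. dominating P le T \<longrightarrow> |S| \<le>o |T| )"

context unbounded_quasi_order
begin

lemma least_dominating_exists: "\<exists>S. least_dominating P le S"
proof -
  let ?R = "card_of ` {S. dominating P le S}"
  have "dominating P le P"
    using le_refl by (auto simp: dominating_def)
  then have "?R \<noteq> {}" by blast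
  then have "\<exists>r \<in> ?R. \<forall>r' \<in> ?R. r \<le>o r'"
    by (rule exists_minim_Card_order) (auto simp: card_of_Card_order)
  then show ?thesis
    unfolding least_dominating_def by auto
qed

text \<open>
  Adding a point \<open>s\<close> to \<open>T\<close>: if the element \<open>q\<close> that escapes \<open>T\<close> lies below \<open>s\<close>, then anything
  strictly above \<open>s\<close> escapes \<open>s\<close> and, being above \<open>q\<close>, also \<open>T\<close>.  Hence dominating sets are infinite,
  so that one more point may be added to a family of fewer than \<open>|S|\<close> points that is to be bounded.
\<close>

lemma finite_not_dominating:
  assumes "finite T" "T \<subseteq> P"
  shows "\<exists>q \<in> P. \<forall>t \<in> T. \<not> le q t"
  using assms
proof induction
  case empty
  show ?case using nonempty by auto
next
  case (insert s T)
  then obtain q where q: "q \<in> P" "\<forall>t \<in> T. \<not> le q t" by blast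
  show ?case
  proof (cases "le q s")
    case True
    obtain s' where s': "s' \<in> P" "lt s s'"
      using unbounded insert.prems by blast
    have "le q s'" using True s'(2) lt_le le_trans by blast
    then have "\<forall>t \<in> insert s T. \<not> le s' t"
      using q(2) s'(2) lt_not_le le_trans by blast
    then show ?thesis using s'(1) by blast
  qed (use q in auto)
qed

lemma infinite_dominating:
  assumes "dominating P le S"
  shows "infinite S"
proof
  assume "finite S"
  then have "\<exists>q \<in> P. \<forall>s \<in> S. \<not> le q s"
    using assms by (intro finite_not_dominating) (simp_all add: dominating_def)
  then show False using assms unfolding dominating_def by fast
qed

text \<open>
  A scale is built by recursion along an enumeration of \<open>S\<close> in order type \<open>|S|\<close>: each value is
  strictly above the fewer than \<open>|S|\<close> earlier ones, and above its own index, which makes the scale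
  dominating.
\<close>

lemma directed_imp_true_cofinality:
  assumes S: "dominating P le S" and directed: "directed_card (card_of S) P le"
  shows "true_cofinality P le lt |S|"
proof -
  have "\<exists>v \<in> P. le x v \<and> (\<forall>y \<in> Y. lt y v)"
    if x: "x \<in> Field |S|" and Y: "Y \<subseteq> P" "|Y| \<le>o |underS |S| x|" for x Y
  proof -
    have "|Y| <o |S|"
      using Y(2) card_of_underS[OF card_of_Card_order x] by (rule ordLeq_ordLess_trans)
    moreover have "|{x}| <o |S|"
      using finite_card_of_ordLess[OF card_of_Card_order] infinite_dominating[OF S] by (metis Field_card_of finite.emptyI finite_insert)
    ultimately have "|Y \<union> {x}| <o |S|"
      by (rule card_of_Un_ordLess_infinite[OF infinite_dominating[OF S]])
    moreover have "Y \<union> {x} \<subseteq> P"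
      using x Y(1) S by (auto simp: dominating_def Field_card_of)
    ultimately obtain u where u: "u \<in> P" "\<forall>y \<in> Y \<union> {x}. le y u"
      using directed_cardD[OF directed] by blast
    obtain v where "v \<in> P" "lt u v"
      using unbounded u(1) by blast
    moreover have "lt y v" if "y \<in> Y \<union> {x}" for y
      using u(2) that le_lt_trans \<open>lt u v\<close> by blast
    ultimately show ?thesis using lt_le by blast
  qed
  from underS_recursion[of "|S|" P "\<lambda>x Y v. le x v \<and> (\<forall>y \<in> Y. lt y v)", OF card_of_Card_order this]
  obtain f where f: "\<And>x. x \<in> S \<Longrightarrow> f x \<in> P \<and> le x (f x) \<and> (\<forall>y \<in> underS |S| x. lt (f y) (f x))"
    by (auto simp: Field_card_of)
  show ?thesis
    unfolding true_cofinality_def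
  proof (intro exI conjI ballI allI impI)
    fix a assume "a \<in> Field |S|"
    then show "f a \<in> P" using f by (simp add: Field_card_of)
  next
    fix a b assume "(a, b) \<in> |S| \<and> a \<noteq> b"
    moreover from this have "b \<in> S" by (metis FieldI2 Field_card_of)
    ultimately show "lt (f a) (f b)" using f by (auto simp: underS_def)
  next
    fix q assume "q \<in> P"
    then obtain s where "s \<in> S" "le q s" using S unfolding dominating_def by blast
    then show "\<exists>a \<in> Field |S|. le q (f a)"
      unfolding Field_card_of using f le_trans by blast
  qed
qed

text \<open>
  Fewer than \<open>|S|\<close> elements are below fewer than \<open>|S|\<close> members of the scale.  By minimality of \<open>S\<close>
  these do not dominate, and an element that escapes them lies below a member of the scale that
  comes after all of them.
\<close>

lemma true_cofinality_imp_directed: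
  assumes r: "Card_order r" and tc: "true_cofinality P le lt r" and S: "least_dominating P le S"
  shows "directed_card (card_of S) P le" "|S| \<le>o r"
proof -
  obtain p where pP: "\<And>a. a \<in> Field r \<Longrightarrow> p a \<in> P"
    and mono: "\<And>a b. (a, b) \<in> r \<Longrightarrow> a \<noteq> b \<Longrightarrow> lt (p a) (p b)"
    and cof: "\<And>q. q \<in> P \<Longrightarrow> \<exists>a \<in> Field r. le q (p a)"
    using tc unfolding true_cofinality_def by blast
  have "dominating P le (p ` Field r)"
    using pP cof unfolding dominating_def by blast
  then have "|S| \<le>o |p ` Field r|"
    using S unfolding least_dominating_def by blast
  also have "|p ` Field r| \<le>o |Field r|" by (rule card_of_image)
  also have "|Field r| =o r" by (rule card_of_Field_ordIso[OF r])
  finally show "|S| \<le>o r" .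
  show "directed_card (card_of S) P le"
    unfolding directed_card_def
  proof (intro allI impI)
    fix X assume X: "X \<subseteq> P" "|X| <o |S|"
    obtain a where a: "\<And>x. x \<in> X \<Longrightarrow> a x \<in> Field r \<and> le x (p (a x))"
      using cof X(1) by (metis subsetD)
    have "\<not> dominating P le (p ` a ` X)"
    proof
      assume "dominating P le (p ` a ` X)"
      then have "|S| \<le>o |p ` a ` X|"
        using S unfolding least_dominating_def by blast
      also have "|p ` a ` X| \<le>o |X|" by (simp add: image_image card_of_image)
      finally show False using X(2) not_ordLess_ordLeq by blast
    qed
    moreover have "p ` a ` X \<subseteq> P" using a pP by auto
    ultimately obtain q where q: "q \<in> P" "\<And>x. x \<in> X \<Longrightarrow> \<not> le q (p (a x))"
      unfolding dominating_def by auto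
    obtain c where c: "c \<in> Field r" "le q (p c)"
      using cof q(1) by blast
    have "le x (p c)" if x: "x \<in> X" for x
    proof -
      have "c \<notin> underS r (a x)"
        using q(2)[OF x] le_trans[OF c(2) lt_le[OF mono]] unfolding underS_def by auto
      then have "(a x, c) \<in> r"
        using Card_order_linear[OF r] a[OF x] c(1) by blast
      then show ?thesis
        using a[OF x] le_trans[OF _ lt_le[OF mono]] by (cases "a x = c") auto
    qed
    then show "\<exists>u \<in> P. \<forall>x \<in> X. le x u" using pP c(1) by blast
  qed
qed

lemma has_tcf_iff_directed:
  assumes "least_dominating P le S"
  shows "has_tcf P le lt \<longleftrightarrow> directed_card (card_of S) P le"
  using assms directed_imp_true_cofinality true_cofinality_imp_directed(1) card_of_Card_order
  unfolding has_tcf_def least_dominating_def by metis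

lemma is_least_card_tcf:
  "has_tcf P le lt \<Longrightarrow> is_least_card (true_cofinality P le lt) (tcf P le lt)"
  unfolding has_tcf_def tcf_def using is_least_card_least_card by metis

lemma tcf_ordIso:
  assumes "has_tcf P le lt" and S: "least_dominating P le S"
  shows "tcf P le lt =o |S|"
proof -
  have least: "is_least_card (true_cofinality P le lt) (tcf P le lt)"
    using assms(1) by (rule is_least_card_tcf)
  have "true_cofinality P le lt |S|"
    using assms has_tcf_iff_directed directed_imp_true_cofinality
    unfolding least_dominating_def by blast
  then have "tcf P le lt \<le>o |S|"
    using least card_of_Card_order unfolding is_least_card_def by blast
  moreover have "|S| \<le>o tcf P le lt"
    using least true_cofinality_imp_directed(2)[OF _ _ S] unfolding is_least_card_def by blast
  ultimately show ?thesis by (simp add: ordIso_iff_ordLeq)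
qed

lemma directed_below_tcf:
  assumes "has_tcf P le lt" "X \<subseteq> P" "|X| <o tcf P le lt"
  shows "\<exists>u \<in> P. \<forall>x \<in> X. le x u"
proof -
  obtain S where S: "least_dominating P le S" using least_dominating_exists by blast
  have "|X| <o |S|"
    using assms(3) tcf_ordIso[OF assms(1) S] by (rule ordLess_ordIso_trans)
  then show ?thesis
    using assms(1,2) by (simp add: has_tcf_iff_directed[OF S] directed_cardD[of "card_of S" P le])
qed

lemma true_cofinality_no_maximum:
  assumes "Card_order r" "true_cofinality P le lt r"
  shows "Field r \<noteq> {}" and "a \<in> Field r \<Longrightarrow> \<exists>b \<in> Field r. a \<noteq> b \<and> (a, b) \<in> r"
proof -
  obtain p where pP: "\<And>a. a \<in> Field r \<Longrightarrow> p a \<in> P"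
    and mono: "\<And>a b. (a, b) \<in> r \<Longrightarrow> a \<noteq> b \<Longrightarrow> lt (p a) (p b)"
    and cof: "\<And>q. q \<in> P \<Longrightarrow> \<exists>a \<in> Field r. le q (p a)"
    using assms(2) unfolding true_cofinality_def by blast
  show "Field r \<noteq> {}" using nonempty cof by blast
  assume a: "a \<in> Field r"
  obtain q where q: "q \<in> P" "lt (p a) q" using unbounded pP a by blast
  obtain b where b: "b \<in> Field r" "le q (p b)" using cof q(1) by blast
  have "\<not> le (p b) (p a)" using q(2) b(2) lt_not_le le_trans by blast
  then have "a \<noteq> b" "b \<notin> underS r a"
    using le_refl pP a mono lt_le unfolding underS_def by blast+
  then show "\<exists>b \<in> Field r. a \<noteq> b \<and> (a, b) \<in> r"
    using Card_order_linear[OF assms(1) a b(1)] b(1) by blast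
qed

end

text \<open>
  One half of a Tukey connection transports dominating sets and directedness in the same
  direction, from \<open>P\<close> to \<open>Q\<close>.
\<close>

lemma Tukey_dominating:
  assumes "\<And>f. f \<in> P \<Longrightarrow> F f \<in> Q" "\<And>g. g \<in> Q \<Longrightarrow> G g \<in> P"
    and "\<And>f g. f \<in> P \<Longrightarrow> g \<in> Q \<Longrightarrow> le (G g) f \<Longrightarrow> le' g (F f)"
    and "dominating P le S"
  shows "dominating Q le' (F ` S)"
  using assms unfolding dominating_def by (fastforce simp: subset_iff)

lemma Tukey_directed:
  assumes F: "\<And>f. f \<in> P \<Longrightarrow> F f \<in> Q" and G: "\<And>g. g \<in> Q \<Longrightarrow> G g \<in> P"
    and FG: "\<And>f g. f \<in> P \<Longrightarrow> g \<in> Q \<Longrightarrow> le (G g) f \<Longrightarrow> le' g (F f)"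
    and directed: "directed_card r P le"
  shows "directed_card r Q le'"
  unfolding directed_card_def
proof (intro allI impI)
  fix X assume X: "X \<subseteq> Q" "|X| <o r"
  have "G ` X \<subseteq> P" using G X(1) by auto
  moreover have "|G ` X| <o r" using card_of_image X(2) by (rule ordLeq_ordLess_trans)
  ultimately obtain u where u: "u \<in> P" "\<forall>y \<in> G ` X. le y u"
    using directed_cardD[OF directed] by blast
  then have "\<forall>x \<in> X. le' x (F u)" using FG X(1) by auto
  then show "\<exists>u \<in> Q. \<forall>x \<in> X. le' x u" using F[OF u(1)] by blast
qed

lemma directed_card_ordIso:
  assumes "r =o s" "directed_card r P le"
  shows "directed_card s P le"
  unfolding directed_card_def
  using directed_cardD[OF assms(2)] ordLess_ordIso_trans[OF _ ordIso_symmetric[OF assms(1)]] by blast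

theorem Tukey_tcf:
  assumes P: "unbounded_quasi_order P le lt" and Q: "unbounded_quasi_order Q le' lt'"
    and F: "\<And>f. f \<in> P \<Longrightarrow> F f \<in> Q" and G: "\<And>g. g \<in> Q \<Longrightarrow> G g \<in> P"
    and FG: "\<And>f g. f \<in> P \<Longrightarrow> g \<in> Q \<Longrightarrow> le (G g) f \<Longrightarrow> le' g (F f)"
    and GF: "\<And>f g. f \<in> P \<Longrightarrow> g \<in> Q \<Longrightarrow> le' (F f) g \<Longrightarrow> le f (G g)"
  shows "(has_tcf P le lt \<longleftrightarrow> has_tcf Q le' lt') \<and>
         (has_tcf P le lt \<longrightarrow> tcf P le lt =o tcf Q le' lt')"
proof -
  obtain S where S: "least_dominating P le S"
    using unbounded_quasi_order.least_dominating_exists[OF P] by blast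
  obtain T where T: "least_dominating Q le' T"
    using unbounded_quasi_order.least_dominating_exists[OF Q] by blast
  have "dominating Q le' (F ` S)"
    by (rule Tukey_dominating[of P F Q G le le', OF F G FG]) (use S in \<open>simp_all add: least_dominating_def\<close>)
  then have "|T| \<le>o |S|"
    using T card_of_image ordLeq_transitive unfolding least_dominating_def by blast
  moreover have "dominating P le (G ` T)"
    by (rule Tukey_dominating[of Q G P F le' le, OF G F GF]) (use T in \<open>simp_all add: least_dominating_def\<close>)
  then have "|S| \<le>o |T|"
    using S card_of_image ordLeq_transitive unfolding least_dominating_def by blast
  ultimately have ST: "|S| =o |T|" by (simp add: ordIso_iff_ordLeq)
  have iff: "has_tcf P le lt \<longleftrightarrow> has_tcf Q le' lt'"
  proof
    assume "has_tcf P le lt"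
    then have "directed_card (card_of S) P le"
      using unbounded_quasi_order.has_tcf_iff_directed[OF P S] by blast
    then have "directed_card (card_of T) Q le'"
      using Tukey_directed[of P F Q G le le', OF F G FG] directed_card_ordIso[OF ST] by blast
    then show "has_tcf Q le' lt'"
      using unbounded_quasi_order.has_tcf_iff_directed[OF Q T] by blast
  next
    assume "has_tcf Q le' lt'"
    then have "directed_card (card_of T) Q le'"
      using unbounded_quasi_order.has_tcf_iff_directed[OF Q T] by blast
    then have "directed_card (card_of S) P le"
      using Tukey_directed[of Q G P F le' le, OF G F GF] directed_card_ordIso[OF ordIso_symmetric[OF ST]]
      by blast
    then show "has_tcf P le lt"
      using unbounded_quasi_order.has_tcf_iff_directed[OF P S] by blast
  qed
  moreover have "tcf P le lt =o tcf Q le' lt'" if tcf: "has_tcf P le lt"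
  proof -
    have "tcf P le lt =o |S|"
      using tcf by (rule unbounded_quasi_order.tcf_ordIso[OF P _ S])
    moreover have "tcf Q le' lt' =o |T|"
      using tcf iff unbounded_quasi_order.tcf_ordIso[OF Q _ T] by blast
    ultimately show ?thesis
      by (rule ordIso_transitive[OF ordIso_transitive[OF _ ST] ordIso_symmetric])
  qed
  ultimately show ?thesis by blast
qed

section \<open>Products of cardinals modulo a filter\<close>

lemma le_mod_dual_ideal: "le_mod (dual_ideal D) lam f g \<longleftrightarrow> (\<forall>\<^sub>F i in D. (f i, g i) \<in> lam i)"
  by (simp add: le_mod_def dual_ideal_def)

lemma less_mod_dual_ideal:
  "less_mod (dual_ideal D) lam f g \<longleftrightarrow> (\<forall>\<^sub>F i in D. (f i, g i) \<in> lam i \<and> f i \<noteq> g i)"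
  by (simp add: less_mod_def dual_ideal_def)

lemma card_prodD: "f \<in> card_prod lam \<Longrightarrow> f i \<in> Field (lam i)"
  by (auto simp: card_prod_def)

lemma card_prodI: "(\<And>i. f i \<in> Field (lam i)) \<Longrightarrow> f \<in> card_prod lam"
  by (auto simp: card_prod_def)

lemma le_mod_trans:
  assumes "\<And>i. Card_order (lam i)"
    and "le_mod (dual_ideal D) lam f g" "le_mod (dual_ideal D) lam g h"
  shows "le_mod (dual_ideal D) lam f h"
  using assms(2,3) unfolding le_mod_dual_ideal
  by eventually_elim (rule Card_order_trans[OF assms(1)])

lemma unbounded_quasi_order_card_prod:
  assumes lam: "\<And>i. Card_order (lam i)" "\<And>i. Field (lam i) \<noteq> {}"
    and no_max: "\<And>i a. a \<in> Field (lam i) \<Longrightarrow> \<exists>b \<in> Field (lam i). a \<noteq> b \<and> (a, b) \<in> lam i"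
    and D: "D \<noteq> bot"
  shows "unbounded_quasi_order (card_prod lam)
           (le_mod (dual_ideal D) lam) (less_mod (dual_ideal D) lam)"
proof
  show "card_prod lam \<noteq> {}"
    using lam(2) by (auto simp: card_prod_def Pi_eq_empty)
next
  fix x assume "x \<in> card_prod lam"
  then show "le_mod (dual_ideal D) lam x x"
    by (simp add: le_mod_dual_ideal Card_order_refl[OF lam(1)] card_prodD)
next
  fix x y z assume "le_mod (dual_ideal D) lam x y" "le_mod (dual_ideal D) lam y z"
  then show "le_mod (dual_ideal D) lam x z"
    by (rule le_mod_trans[OF lam(1)])
next
  fix x y assume "less_mod (dual_ideal D) lam x y"
  then show "le_mod (dual_ideal D) lam x y"
    unfolding le_mod_dual_ideal less_mod_dual_ideal by eventually_elim simp
next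
  fix x y assume lt: "less_mod (dual_ideal D) lam x y"
  show "\<not> le_mod (dual_ideal D) lam y x"
  proof
    assume "le_mod (dual_ideal D) lam y x"
    with lt have "\<forall>\<^sub>F i in D. False"
      unfolding le_mod_dual_ideal less_mod_dual_ideal
      by eventually_elim (use Card_order_antisym[OF lam(1)] in blast)
    then show False using D by (simp add: trivial_limit_def)
  qed
next
  fix x y z assume "le_mod (dual_ideal D) lam x y" "less_mod (dual_ideal D) lam y z"
  then show "less_mod (dual_ideal D) lam x z"
    unfolding le_mod_dual_ideal less_mod_dual_ideal
    by eventually_elim (metis Card_order_trans[OF lam(1)] Card_order_antisym[OF lam(1)])
next
  fix x assume x: "x \<in> card_prod lam"
  have "\<forall>i. \<exists>b. b \<in> Field (lam i) \<and> x i \<noteq> b \<and> (x i, b) \<in> lam i"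
    using no_max[OF card_prodD[OF x]] by blast
  then obtain y where "\<And>i. y i \<in> Field (lam i) \<and> x i \<noteq> y i \<and> (x i, y i) \<in> lam i"
    unfolding choice_iff by blast
  then show "\<exists>y \<in> card_prod lam. less_mod (dual_ideal D) lam x y"
    by (intro bexI[of _ y]) (auto simp: less_mod_dual_ideal intro: card_prodI)
qed

lemma regularCard_bounded:
  assumes r: "Card_order r" "regularCard r" and K: "K \<subseteq> Field r" "|K| <o r"
  shows "\<exists>a \<in> Field r. \<forall>b \<in> K. (b, a) \<in> r"
proof -
  have "\<not> cofinal K r"
    using r(2) K not_ordLess_ordIso unfolding regularCard_def by blast
  then obtain a where "a \<in> Field r" "\<And>b. b \<in> K \<Longrightarrow> a \<notin> underS r b"
    unfolding cofinal_def underS_def by blast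
  then show ?thesis
    using Card_order_linear[OF r(1)] K(1) by blast
qed

lemma pointwise_bound:
  fixes lam :: "'k \<Rightarrow> 'a rel"
  assumes lam: "\<And>i. Card_order (lam i) \<and> infinite (Field (lam i)) \<and> regularCard (lam i)"
    and F: "F \<subseteq> card_prod lam"
  shows "\<exists>u \<in> card_prod lam. \<forall>i. |F| <o lam i \<longrightarrow> (\<forall>f \<in> F. (f i, u i) \<in> lam i)"
proof -
  have bound: "\<exists>a. a \<in> Field (lam i) \<and> ( |F| <o lam i \<longrightarrow> (\<forall>f \<in> F. (f i, a) \<in> lam i))" for i
  proof (cases "|F| <o lam i")
    case True
    have "(\<lambda>f. f i) ` F \<subseteq> Field (lam i)"
      using F card_prodD[of _ lam i] by auto
    moreover have "|(\<lambda>f. f i) ` F| <o lam i"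
      using card_of_image True by (rule ordLeq_ordLess_trans)
    ultimately have "\<exists>a \<in> Field (lam i). \<forall>b \<in> (\<lambda>f. f i) ` F. (b, a) \<in> lam i"
      using lam by (intro regularCard_bounded) blast+
    then show ?thesis by blast
  next
    case False
    moreover obtain a where "a \<in> Field (lam i)" using lam[of i] by fastforce
    ultimately show ?thesis by blast
  qed
  obtain u where "\<And>i. u i \<in> Field (lam i) \<and> ( |F| <o lam i \<longrightarrow> (\<forall>f \<in> F. (f i, u i) \<in> lam i))"
    using choice[of "\<lambda>i a. a \<in> Field (lam i) \<and> ( |F| <o lam i \<longrightarrow> (\<forall>f \<in> F. (f i, a) \<in> lam i))"] bound
    by blast
  then show ?thesis by (intro bexI[of _ u]) (auto intro: card_prodI)
qed

section \<open>Weak saturation and joint bounds\<close>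

text \<open>
  Disjoint positive sets need not cover; putting the leftover points into one of them turns the
  family into a partition of the same cardinality.
\<close>

lemma no_disjoint_positive_family:
  fixes I :: "'k set set" and A :: "'k set \<Rightarrow> 'k set"
  assumes I: "proper_ideal I"
    and disj: "\<And>a b. a \<in> Field (wsat I) \<Longrightarrow> b \<in> Field (wsat I) \<Longrightarrow> a \<noteq> b \<Longrightarrow> A a \<inter> A b = {}"
    and pos: "\<And>a. a \<in> Field (wsat I) \<Longrightarrow> A a \<notin> I"
  shows False
proof -
  let ?W = "Field (wsat I)"
  have W: "Card_order (wsat I)" "?W \<noteq> {}"
    and no_part: "\<not> (\<exists>\<A>. partition_on UNIV \<A> \<and> (\<forall>A \<in> \<A>. A \<notin> I) \<and> |\<A>| =o wsat I)"
    using is_least_card_wsat[of I] unfolding is_least_card_def by auto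
  obtain c where c: "c \<in> ?W" using W(2) by blast
  define B where "B a = (if a = c then - (\<Union>b \<in> ?W - {c}. A b) else A a)" for a
  have A_B: "A a \<subseteq> B a" if "a \<in> ?W" for a
    using disj that unfolding B_def by auto
  have B_pos: "B a \<notin> I" if "a \<in> ?W" for a
    using pos[OF that] A_B[OF that] I unfolding proper_ideal_def by blast
  have B_disj: "B a \<inter> B b = {}" if "a \<in> ?W" "b \<in> ?W" "a \<noteq> b" for a b
    using disj that unfolding B_def by auto
  have B_ne: "B a \<noteq> {}" if "a \<in> ?W" for a
    using B_pos[OF that] I unfolding proper_ideal_def by auto
  have inj: "inj_on B ?W"
    using B_disj B_ne by (metis Int_absorb inj_onI)
  have "|B ` ?W| =o |?W|"
    by (rule ordIso_symmetric[OF card_of_ordIsoI[OF inj_on_imp_bij_betw[OF inj]]])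
  then have "|B ` ?W| =o wsat I"
    by (rule ordIso_transitive[OF _ card_of_Field_ordIso[OF W(1)]])
  moreover have "partition_on UNIV (B ` ?W)"
    unfolding partition_on_def disjoint_def
  proof (intro conjI ballI impI)
    show "\<Union> (B ` ?W) = UNIV" using c unfolding B_def by auto
    show "p \<inter> q = {}" if "p \<in> B ` ?W" "q \<in> B ` ?W" "p \<noteq> q" for p q
      using that B_disj by auto
    show "{} \<notin> B ` ?W" using B_ne by auto
  qed
  ultimately show False using no_part B_pos by blast
qed

text \<open>
  In the supremum of \<open>\<D>\<close> an event is large iff it is large for every \<open>D \<in> \<D>\<close>, so a failure to be
  bounded modulo the supremum is witnessed by a single \<open>D\<close>.

  A finite \<open>F\<close> is bounded pointwise, and one with \<open>|F| \<le> \<theta>\<close> is bounded modulo \<open>I\<close>.  Beyond that,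
  induction on \<open>|F|\<close> allows to replace \<open>F\<close> by an increasing sequence \<open>c\<close> of length \<open>|F|\<close>.
  If \<open>c\<close> has no bound, then every \<open>g\<close> is overtaken: some \<open>c x\<close> is not below \<open>g\<close> modulo some
  \<open>D \<in> \<D>\<close>, while all of \<open>c\<close> has a bound \<open>H g\<close> modulo that \<open>D\<close>.  Iterating \<open>H\<close> along \<open>wsat I\<close>
  gives \<open>g\<^sub>b\<close> which is above all \<open>H (g\<^sub>a)\<close>, \<open>a < b\<close>, off a set \<open>N\<^sub>b \<in> I\<close>.  Since \<open>\<theta> < |F|\<close>, one
  index \<open>z\<close> serves as witness for all \<open>b\<close>.  The sets of those \<open>i \<notin> N\<^sub>b\<close> for which \<open>c z\<close> at \<open>i\<close> lies above \<open>g\<^sub>b\<close>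
  but not above \<open>H (g\<^sub>b)\<close> are then positive and disjoint, against \<open>no_disjoint_positive_family\<close>.

  The exceptional sets \<open>N\<^sub>b\<close> are fixed in advance by the size of the cardinals \<open>\<lambda>\<^sub>i\<close>.  This makes
  the positive sets truly disjoint; sets that are disjoint only modulo \<open>I\<close> could in general not be
  made disjoint, as \<open>I\<close> need not be closed under unions of that length.
\<close>

theorem bounded_mod_Sup:
  fixes lam :: "'k \<Rightarrow> 'a rel" and I :: "'k set set" and \<D> :: "'k filter set"
  assumes lam: "\<And>i. Card_order (lam i) \<and> infinite (Field (lam i)) \<and> regularCard (lam i)"
    and I: "proper_ideal I"
    and theta: "Card_order theta" "wsat I \<le>o theta"
    and small: "\<And>b. b \<in> Field (wsat I) \<Longrightarrow> {i. lam i \<le>o |underS (wsat I) b|} \<in> I"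
    and base: "\<And>F. F \<subseteq> card_prod lam \<Longrightarrow> |F| \<le>o theta \<Longrightarrow>
                 \<exists>u \<in> card_prod lam. \<forall>f \<in> F. le_mod I lam f u"
    and \<D>: "\<And>D. D \<in> \<D> \<Longrightarrow> I \<subseteq> dual_ideal D"
    and F: "F \<subseteq> card_prod lam"
    and F_bounded: "\<And>D G. D \<in> \<D> \<Longrightarrow> G \<subseteq> card_prod lam \<Longrightarrow> |G| \<le>o |F| \<Longrightarrow>
                 \<exists>u \<in> card_prod lam. \<forall>f \<in> G. le_mod (dual_ideal D) lam f u"
  shows "\<exists>u \<in> card_prod lam. \<forall>f \<in> F. le_mod (dual_ideal (Sup \<D>)) lam f u"
  using F F_bounded
proof (induction F rule: wf_induct_rule[OF wf_inv_image[OF wf_ordLess, where f = card_of]])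
  case (1 F)
  note F = 1(2)
  let ?P = "card_prod lam"
  let ?le = "le_mod (dual_ideal (Sup \<D>)) lam"
  let ?W = "wsat I"
  have le_trans: "?le f g \<Longrightarrow> ?le g h \<Longrightarrow> ?le f h" for f g h
    using lam by (blast intro: le_mod_trans[of lam _ f g h])
  have I_Sup: "I \<subseteq> dual_ideal (Sup \<D>)"
    using \<D> unfolding dual_ideal_def eventually_Sup by blast
  have IH: "\<exists>u \<in> ?P. \<forall>f \<in> G. ?le f u" if G: "G \<subseteq> ?P" "|G| <o |F|" for G
  proof (rule 1(1))
    show "(G, F) \<in> inv_image ordLess card_of" using G(2) by simp
    show "G \<subseteq> ?P" by (rule G(1))
    show "\<exists>u \<in> ?P. \<forall>f \<in> H. le_mod (dual_ideal D) lam f u"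
      if "D \<in> \<D>" "H \<subseteq> ?P" "|H| \<le>o |G|" for D H
      using 1(3)[OF that(1,2)] ordLeq_transitive[OF that(3) ordLess_imp_ordLeq[OF G(2)]] by blast
  qed
  consider "finite F" | "|F| \<le>o theta" | "infinite F" "theta <o |F|"
    using ordLess_or_ordLeq[OF card_order_on_well_order_on[OF theta(1)] card_of_Well_order] by blast
  then show ?case
  proof cases
    case 1
    then have "|F| <o lam i" for i
      using lam finite_card_of_ordLess by blast
    then obtain u where "u \<in> ?P" "\<forall>f \<in> F. \<forall>i. (f i, u i) \<in> lam i"
      using pointwise_bound[OF lam F] by blast
    then show ?thesis
      by (intro bexI[of _ u]) (simp_all add: le_mod_dual_ideal)
  next
    case 2
    then show ?thesis
      using base[OF F] I_Sup unfolding le_mod_def by blast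
  next
    case 3
    have "\<exists>v \<in> ?P. ?le x v \<and> (\<forall>y \<in> Y. ?le y v)"
      if x: "x \<in> Field |F|" and Y: "Y \<subseteq> ?P" "|Y| \<le>o |underS |F| x|" for x Y
    proof -
      have "|Y| <o |F|"
        using Y(2) card_of_underS[OF card_of_Card_order x] by (rule ordLeq_ordLess_trans)
      moreover have "|{x}| <o |F|"
        using finite_card_of_ordLess[OF card_of_Card_order] 3(1) by (metis Field_card_of finite.emptyI finite_insert)
      ultimately have "|Y \<union> {x}| <o |F|"
        by (rule card_of_Un_ordLess_infinite[OF 3(1)])
      moreover have "Y \<union> {x} \<subseteq> ?P" using x Y(1) F by (auto simp: Field_card_of)
      ultimately show ?thesis using IH[of "Y \<union> {x}"] by blast
    qed
    from underS_recursion[of "|F|" ?P "\<lambda>x Y v. ?le x v \<and> (\<forall>y \<in> Y. ?le y v)",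
        OF card_of_Card_order this]
    obtain c where c: "\<And>x. x \<in> F \<Longrightarrow> c x \<in> ?P \<and> ?le x (c x) \<and> (\<forall>y \<in> underS |F| x. ?le (c y) (c x))"
      by (auto simp: Field_card_of)
    show ?thesis
    proof (rule ccontr)
      assume unbdd: "\<not> ?thesis"
      define overtakes where "overtakes g D x h \<longleftrightarrow>
          D \<in> \<D> \<and> x \<in> F \<and> \<not> (\<forall>\<^sub>F i in D. (c x i, g i) \<in> lam i) \<and> h \<in> ?P \<and>
          (\<forall>y \<in> F. \<forall>\<^sub>F i in D. (c y i, h i) \<in> lam i)" for g D x h
      have "\<exists>D x h. overtakes g D x h" if g: "g \<in> ?P" for g
      proof -
        obtain x where x: "x \<in> F" "\<not> ?le (c x) g"
          using unbdd g c le_trans by blast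
        then obtain D where D: "D \<in> \<D>" "\<not> (\<forall>\<^sub>F i in D. (c x i, g i) \<in> lam i)"
          unfolding le_mod_dual_ideal eventually_Sup by blast
        have "\<exists>h \<in> ?P. \<forall>f \<in> c ` F. le_mod (dual_ideal D) lam f h"
          using c by (intro 1(3)[OF D(1)]) (auto simp: card_of_image)
        then show ?thesis using x D unfolding le_mod_dual_ideal overtakes_def by blast
      qed
      then obtain K X H where "\<And>g. g \<in> ?P \<Longrightarrow> overtakes g (K g) (X g) (H g)"
        by metis
      then have KXH: "g \<in> ?P \<Longrightarrow> K g \<in> \<D> \<and> X g \<in> F \<and>
          \<not> (\<forall>\<^sub>F i in K g. (c (X g) i, g i) \<in> lam i) \<and> H g \<in> ?P \<and>
          (\<forall>y \<in> F. \<forall>\<^sub>F i in K g. (c y i, H g i) \<in> lam i)" for g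
        unfolding overtakes_def by blast
      define N where "N b = {i. lam i \<le>o |underS ?W b|}" for b
      have W: "Card_order ?W"
        using is_least_card_wsat[of I] unfolding is_least_card_def by blast
      have "\<exists>v \<in> ?P. \<forall>g \<in> Y. \<forall>i. i \<notin> N b \<longrightarrow> (H g i, v i) \<in> lam i"
        if b: "b \<in> Field ?W" and Y: "Y \<subseteq> ?P" "|Y| \<le>o |underS ?W b|" for b Y
      proof -
        have "H ` Y \<subseteq> ?P" using KXH Y(1) by blast
        from pointwise_bound[OF lam this]
        obtain v where v: "v \<in> ?P" "\<forall>i. |H ` Y| <o lam i \<longrightarrow> (\<forall>f \<in> H ` Y. (f i, v i) \<in> lam i)"
          by blast
        have "|H ` Y| <o lam i" if "i \<notin> N b" for i
        proof -
          have "Well_order (lam i)" using lam card_order_on_well_order_on by blast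
          then have "|underS ?W b| <o lam i"
            using that not_ordLeq_iff_ordLess[OF card_of_Well_order] unfolding N_def by blast
          then show ?thesis
            by (rule ordLeq_ordLess_trans[OF ordLeq_transitive[OF card_of_image Y(2)]])
        qed
        then show ?thesis using v by blast
      qed
      from underS_recursion[of ?W ?P "\<lambda>b Y v. \<forall>g \<in> Y. \<forall>i. i \<notin> N b \<longrightarrow> (H g i, v i) \<in> lam i",
          OF W this]
      obtain g where gP: "\<And>b. b \<in> Field ?W \<Longrightarrow> g b \<in> ?P"
        and g: "\<And>a b i. b \<in> Field ?W \<Longrightarrow> a \<in> underS ?W b \<Longrightarrow> i \<notin> N b \<Longrightarrow> (H (g a) i, g b i) \<in> lam i"
        by blast
      \<comment> \<open>Were the witnesses cofinal in the sequence, a bound of these at most \<open>\<theta>\<close> many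
        functions would bound \<open>F\<close>.\<close>
      have "\<exists>z \<in> F. \<forall>b \<in> Field ?W. ?le (c (X (g b))) (c z)"
      proof (rule ccontr)
        assume no_z: "\<not> ?thesis"
        let ?Y = "(\<lambda>b. c (X (g b))) ` Field ?W"
        have "|?Y| \<le>o |Field ?W|" by (rule card_of_image)
        also have "|Field ?W| =o ?W" by (rule card_of_Field_ordIso[OF W])
        also have "?W \<le>o theta" by (rule theta(2))
        also have "theta <o |F|" by (rule 3(2))
        finally have "|?Y| <o |F|" .
        moreover have "?Y \<subseteq> ?P" using c KXH gP by blast
        ultimately obtain u where u: "u \<in> ?P" "\<And>b. b \<in> Field ?W \<Longrightarrow> ?le (c (X (g b))) u"
          using IH[of ?Y] by blast
        have "?le z u" if z: "z \<in> F" for z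
        proof -
          obtain b where b: "b \<in> Field ?W" "\<not> ?le (c (X (g b))) (c z)"
            using no_z z by blast
          have X: "X (g b) \<in> F" using KXH gP b(1) by blast
          have "X (g b) \<notin> underS |F| z" using b(2) c[OF z] by blast
          then have "(z, X (g b)) \<in> |F|"
            using Card_order_linear[of "|F|" z "X (g b)", unfolded Field_card_of]
              card_of_card_order_on z X by blast
          then have "z = X (g b) \<or> ?le (c z) (c (X (g b)))"
            using c[OF X] unfolding underS_def by blast
          then have "?le z (c (X (g b)))" using c[OF z] le_trans by auto
          then show ?thesis using u(2)[OF b(1)] le_trans by blast
        qed
        then show False using unbdd u(1) by blast
      qed
      then obtain z where z: "z \<in> F" "\<And>b. b \<in> Field ?W \<Longrightarrow> ?le (c (X (g b))) (c z)" by blast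
      define A where
        "A b = {i. (c z i, g b i) \<notin> lam i \<and> (c z i, H (g b) i) \<in> lam i \<and> i \<notin> N b}" for b
      show False
      proof (rule no_disjoint_positive_family[OF I, of A])
        fix b assume b: "b \<in> Field ?W"
        note KXHb = KXH[OF gP[OF b]]
        show "A b \<notin> I"
        proof
          assume "A b \<in> I"
          then have "\<forall>\<^sub>F i in K (g b). i \<notin> A b"
            using \<D> KXHb unfolding dual_ideal_def by blast
          moreover have "\<forall>\<^sub>F i in K (g b). i \<notin> N b"
            using \<D> KXHb small[OF b] unfolding dual_ideal_def N_def by blast
          moreover have "\<forall>\<^sub>F i in K (g b). (c z i, H (g b) i) \<in> lam i"
            using KXHb z(1) by blast
          moreover have "\<forall>\<^sub>F i in K (g b). (c (X (g b)) i, c z i) \<in> lam i"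
            using z(2)[OF b] KXHb unfolding le_mod_dual_ideal eventually_Sup by blast
          ultimately have "\<forall>\<^sub>F i in K (g b). (c (X (g b)) i, g b i) \<in> lam i"
          proof eventually_elim
            case (elim i)
            then have "(c z i, g b i) \<in> lam i" unfolding A_def by blast
            with elim(4) show ?case using Card_order_trans[of "lam i"] lam[of i] by blast
          qed
          then show False using KXHb by blast
        qed
      next
        have disj: "A a \<inter> A b = {}" if ba: "b \<in> Field ?W" "a \<in> underS ?W b" for a b
        proof -
          have "i \<notin> A b" if "i \<in> A a" for i
          proof
            assume "i \<in> A b"
            then have "i \<notin> N b" "(c z i, g b i) \<notin> lam i" by (simp_all add: A_def)
            moreover have "(c z i, H (g a) i) \<in> lam i" using that by (simp add: A_def)
            ultimately show False
              using g[OF ba] Card_order_trans[of "lam i"] lam[of i] by blast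
          qed
          then show ?thesis by blast
        qed
        fix a b assume "a \<in> Field ?W" "b \<in> Field ?W" "a \<noteq> b"
        then have "a \<in> underS ?W b \<or> b \<in> underS ?W a"
          using Card_order_linear[OF W, of a b] unfolding underS_def by blast
        then show "A a \<inter> A b = {}"
          using disj \<open>a \<in> Field ?W\<close> \<open>b \<in> Field ?W\<close> by blast
      qed
    qed
  qed
qed

text \<open>
  Both alternatives of the claim serve only through two consequences.  An initial segment of
  \<open>wsat I\<close> is smaller than \<open>\<theta>\<close>, hence smaller than \<open>\<lambda>\<^sub>i\<close> for all \<open>i\<close> off a set in \<open>I\<close>; and \<open>\<theta>\<close> many
  functions have a bound modulo \<open>I\<close>, pointwise in the first case and by assumption in the second.
\<close>

lemma min_or_liminf_hypothesis:
  fixes lam :: "'k \<Rightarrow> 'a rel" and I :: "'k set set"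
  assumes lam: "\<And>i. Card_order (lam i) \<and> infinite (Field (lam i)) \<and> regularCard (lam i)"
    and I: "proper_ideal I"
    and theta: "Card_order theta"
    and alpha_or_beta:
      "((\<forall>i. theta <o lam i) \<and> wsat I \<le>o theta) \<or>
       (theta \<le>o liminf_mod I lam \<and> wsat I \<le>o theta \<and>
        directed_card (cardSuc theta) (card_prod lam) (le_mod I lam))"
  shows "b \<in> Field (wsat I) \<Longrightarrow> {i. lam i \<le>o |underS (wsat I) b|} \<in> I"
    and "F \<subseteq> card_prod lam \<Longrightarrow> |F| \<le>o theta \<Longrightarrow> \<exists>u \<in> card_prod lam. \<forall>f \<in> F. le_mod I lam f u"
proof -
  have empty: "{} \<in> I" using I unfolding proper_ideal_def by blast
  have W: "Card_order (wsat I)"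
    using is_least_card_wsat[of I] unfolding is_least_card_def by blast
  show "{i. lam i \<le>o |underS (wsat I) b|} \<in> I" if b: "b \<in> Field (wsat I)"
  proof -
    let ?U = "underS (wsat I) b"
    have U: "|?U| <o theta"
      using card_of_underS[OF W b] alpha_or_beta ordLess_ordLeq_trans by blast
    from alpha_or_beta show ?thesis
    proof (elim disjE conjE)
      assume "\<forall>i. theta <o lam i"
      then have "|?U| <o lam i" for i
        by (blast intro: ordLess_transitive[OF U])
      then have "\<not> lam i \<le>o |?U|" for i
        by (rule not_ordLess_ordLeq)
      then show ?thesis using empty by simp
    next
      assume "theta \<le>o liminf_mod I lam"
      then have less: "|?U| <o liminf_mod I lam" by (rule ordLess_ordLeq_trans[OF U])
      obtain V where V: "|?U| =o |V|" "V \<subseteq> Field (liminf_mod I lam)" "|V| <o liminf_mod I lam"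
        using iffD1[OF internalize_card_of_ordLess less] by blast
      have "{i. lam i \<le>o |V|} \<in> I"
        using is_least_card_liminf_mod[OF I, of lam] lam V(3) card_of_Card_order not_ordLess_ordLeq
        unfolding is_least_card_def by blast
      moreover have "{i. lam i \<le>o |?U|} = {i. lam i \<le>o |V|}"
        using ordLeq_ordIso_trans[OF _ V(1)] ordLeq_ordIso_trans[OF _ ordIso_symmetric[OF V(1)]]
        by auto
      ultimately show ?thesis by simp
    qed
  qed
  show "\<exists>u \<in> card_prod lam. \<forall>f \<in> F. le_mod I lam f u"
    if F: "F \<subseteq> card_prod lam" "|F| \<le>o theta"
    using alpha_or_beta
  proof (elim disjE conjE)
    assume "\<forall>i. theta <o lam i"
    then have "|F| <o lam i" for i by (blast intro: ordLeq_ordLess_trans[OF F(2)])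
    then obtain u where "u \<in> card_prod lam" "\<forall>f \<in> F. \<forall>i. (f i, u i) \<in> lam i"
      using pointwise_bound[OF lam F(1)] by blast
    then show ?thesis
      using empty by (intro bexI[of _ u]) (simp_all add: le_mod_def)
  next
    assume directed: "directed_card (cardSuc theta) (card_prod lam) (le_mod I lam)"
    have "|F| <o cardSuc theta"
      using F(2) cardSuc_ordLeq_ordLess[OF theta card_of_Card_order] by blast
    then show ?thesis by (rule directed_cardD[OF directed F(1)])
  qed
qed

section \<open>The true cofinality modulo the filter composed from \<open>E\<close> and the \<open>D\<^sub>j\<close>\<close>

theorem claim1p10:
  fixes lam :: "'k \<Rightarrow> 'a rel"
    and I :: "'k set set"
    and theta :: "'t rel"
    and D :: "'s \<Rightarrow> 'k filter"
    and E :: "'s filter"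
    and mu :: "'s \<Rightarrow> ('k \<Rightarrow> 'a) rel"
    and Dstar :: "'k filter"
  assumes kappa: "infinite (UNIV :: 'k set)"
    and lam: "\<And>i. Card_order (lam i) \<and> infinite (Field (lam i)) \<and> regularCard (lam i)"
    and I: "proper_ideal I"
    and theta: "Card_order theta"
    and alpha_or_beta:
      "((\<forall>i. theta <o lam i) \<and> wsat I \<le>o theta) \<or>
       (theta \<le>o liminf_mod I lam \<and> wsat I \<le>o theta \<and>
        directed_card (cardSuc theta) (card_prod lam) (le_mod I lam))"
    and D: "\<And>j. D j \<noteq> bot \<and> I \<subseteq> dual_ideal (D j)"
    and E: "E \<noteq> bot"
    and Dstar: "Dstar = bind_filter E D"
    and mu_well_defined: "\<And>j. has_prod_tcf lam (D j)"
    and mu: "\<And>j. mu j = prod_tcf lam (D j)"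
    and mu_large: "\<And>j. |UNIV :: 's set| +c theta <o mu j"
  shows "(has_prod_tcf lam Dstar \<longleftrightarrow> has_prod_tcf mu E) \<and>
         (has_prod_tcf lam Dstar \<longrightarrow> prod_tcf lam Dstar =o prod_tcf mu E)"
proof -
  let ?P = "card_prod lam"
  let ?le = "\<lambda>D. le_mod (dual_ideal D) lam"
  have lam_Card: "Card_order (lam i)" and lam_ne: "Field (lam i) \<noteq> {}" for i
    using lam[of i] by auto
  have lam_no_max: "\<exists>b \<in> Field (lam i). a \<noteq> b \<and> (a, b) \<in> lam i" if "a \<in> Field (lam i)" for i a
    using lam[of i] infinite_Card_order_limit[of "lam i" a] that by blast
  have qo: "unbounded_quasi_order ?P (?le K) (less_mod (dual_ideal K) lam)" if "K \<noteq> bot" for K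
    using that by (intro unbounded_quasi_order_card_prod lam_Card lam_ne lam_no_max)
  have qoD: "unbounded_quasi_order ?P (?le (D j)) (less_mod (dual_ideal (D j)) lam)" for j
    using D qo by blast
  have le_trans: "?le K f g \<Longrightarrow> ?le K g h \<Longrightarrow> ?le K f h" for K f g h
    using lam by (blast intro: le_mod_trans[of lam _ f g h])
  have mu_least: "is_least_card (true_cofinality ?P (?le (D j)) (less_mod (dual_ideal (D j)) lam)) (mu j)"
    for j
    using unbounded_quasi_order.is_least_card_tcf[OF qoD] mu_well_defined
    unfolding mu prod_tcf_def has_prod_tcf_def by blast
  then have mu_Card: "Card_order (mu j)"
    and mu_tc: "true_cofinality ?P (?le (D j)) (less_mod (dual_ideal (D j)) lam) (mu j)" for j
    unfolding is_least_card_def by blast+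
  then have "\<forall>j. \<exists>p. (\<forall>a \<in> Field (mu j). p a \<in> ?P) \<and>
      (\<forall>a b. (a, b) \<in> mu j \<and> a \<noteq> b \<longrightarrow> less_mod (dual_ideal (D j)) lam (p a) (p b)) \<and>
      (\<forall>q \<in> ?P. \<exists>a \<in> Field (mu j). ?le (D j) q (p a))"
    unfolding true_cofinality_def by blast
  then obtain p where pP: "\<And>j a. a \<in> Field (mu j) \<Longrightarrow> p j a \<in> ?P"
    and p_mono: "\<And>j a b. (a, b) \<in> mu j \<Longrightarrow> a \<noteq> b \<Longrightarrow> less_mod (dual_ideal (D j)) lam (p j a) (p j b)"
    and p_cof: "\<And>j q. q \<in> ?P \<Longrightarrow> \<exists>a \<in> Field (mu j). ?le (D j) q (p j a)"
    unfolding choice_iff by blast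
  have p_le: "?le (D j) (p j a) (p j b)" if "(a, b) \<in> mu j" for j a b
    using that p_mono unbounded_quasi_order.lt_le[OF qoD] unbounded_quasi_order.le_refl[OF qoD]
      pP FieldI1 by metis
  have p_reflect: "(a, b) \<in> mu j"
    if "a \<in> Field (mu j)" "b \<in> Field (mu j)" "?le (D j) (p j a) (p j b)" for j a b
    using that Card_order_linear[OF mu_Card] p_mono unbounded_quasi_order.lt_not_le[OF qoD]
    unfolding underS_def by blast
  have "Dstar \<noteq> bot"
    using D E unfolding Dstar trivial_limit_def eventually_bind_filter by simp
  then have qo_star: "unbounded_quasi_order ?P (?le Dstar) (less_mod (dual_ideal Dstar) lam)"
    by (rule qo)
  have qo_mu: "unbounded_quasi_order (card_prod mu)
      (le_mod (dual_ideal E) mu) (less_mod (dual_ideal E) mu)"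
    using unbounded_quasi_order.true_cofinality_no_maximum[OF qoD mu_Card mu_tc]
    by (intro unbounded_quasi_order_card_prod mu_Card E) auto

  define F where "F f j = (SOME a. a \<in> Field (mu j) \<and> ?le (D j) f (p j a))" for f j
  have F: "F f j \<in> Field (mu j) \<and> ?le (D j) f (p j (F f j))" if "f \<in> ?P" for f j
    unfolding F_def by (rule someI_ex[where P = "\<lambda>a. a \<in> Field (mu j) \<and> ?le (D j) f (p j a)"])
      (use p_cof[OF that] in blast)

  have "\<exists>h \<in> ?P. \<forall>j. ?le (D j) (p j (g j)) h" if g: "g \<in> card_prod mu" for g
  proof -
    let ?R = "range (\<lambda>j. p j (g j))"
    have R: "?R \<subseteq> ?P" using pP card_prodD[OF g] by blast
    have "\<exists>h \<in> ?P. \<forall>f \<in> ?R. ?le (Sup (range D)) f h"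
    proof (rule bounded_mod_Sup[OF lam I theta])
      show "wsat I \<le>o theta" using alpha_or_beta by blast
      show "{i. lam i \<le>o |underS (wsat I) b|} \<in> I" if "b \<in> Field (wsat I)" for b
        by (rule min_or_liminf_hypothesis(1)[OF lam I theta alpha_or_beta that])
      show "\<exists>u \<in> ?P. \<forall>f \<in> X. le_mod I lam f u" if "X \<subseteq> ?P" "|X| \<le>o theta" for X
        by (rule min_or_liminf_hypothesis(2)[OF lam I theta alpha_or_beta that])
      show "I \<subseteq> dual_ideal K" if "K \<in> range D" for K using that D by blast
      show "?R \<subseteq> ?P" by (rule R)
      show "\<exists>u \<in> ?P. \<forall>f \<in> X. ?le K f u"
        if K: "K \<in> range D" and X: "X \<subseteq> ?P" "|X| \<le>o |?R|" for K X
      proof -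
        obtain j where j: "K = D j" using K by blast
        have "|X| \<le>o |UNIV :: 's set|" using X(2) card_of_image by (rule ordLeq_transitive)
        also have "|UNIV :: 's set| \<le>o |UNIV :: 's set| +c theta"
          by (rule ordLeq_csum1[OF card_of_Card_order])
        also have "|UNIV :: 's set| +c theta <o mu j" by (rule mu_large)
        finally have "|X| <o mu j" .
        then show ?thesis
          using unbounded_quasi_order.directed_below_tcf[OF qoD, of j X] mu_well_defined X(1)
          unfolding j mu prod_tcf_def has_prod_tcf_def by blast
      qed
    qed
    then show ?thesis
      unfolding le_mod_dual_ideal eventually_Sup by blast
  qed
  then obtain G where G: "\<And>g. g \<in> card_prod mu \<Longrightarrow> G g \<in> ?P \<and> (\<forall>j. ?le (D j) (p j (g j)) (G g))"
    by metis

  have star: "?le Dstar f h \<longleftrightarrow> (\<forall>\<^sub>F j in E. ?le (D j) f h)" for f h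
    by (simp add: le_mod_dual_ideal Dstar eventually_bind_filter)
  show ?thesis
    unfolding has_prod_tcf_def prod_tcf_def
  proof (rule Tukey_tcf[OF qo_star qo_mu, where F = F and G = G])
    fix f assume "f \<in> ?P"
    then show "F f \<in> card_prod mu" using F by (intro card_prodI) blast
  next
    fix g assume "g \<in> card_prod mu"
    then show "G g \<in> ?P" using G by blast
  next
    fix f g assume f: "f \<in> ?P" and g: "g \<in> card_prod mu" and "?le Dstar (G g) f"
    then have "\<forall>\<^sub>F j in E. ?le (D j) (G g) f" unfolding star by blast
    then show "le_mod (dual_ideal E) mu g (F f)"
      unfolding le_mod_dual_ideal[of E]
    proof eventually_elim
      case (elim j)
      then have "?le (D j) (p j (g j)) (p j (F f j))"
        using F[OF f] G[OF g] le_trans by blast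
      then show ?case
        using p_reflect card_prodD[OF g] F[OF f] by blast
    qed
  next
    fix f g assume f: "f \<in> ?P" and g: "g \<in> card_prod mu" and "le_mod (dual_ideal E) mu (F f) g"
    then have "\<forall>\<^sub>F j in E. (F f j, g j) \<in> mu j" unfolding le_mod_dual_ideal by blast
    then show "?le Dstar f (G g)"
      unfolding star
    proof eventually_elim
      case (elim j)
      then show ?case using p_le F[OF f] G[OF g] le_trans by blast
    qed
  qed
qed

end
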